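(* Assume that the linear map $A$ is surjective. Let $P$ be a positive semidefinite matrix (self-adjoint linear operator) on $\mathcal Z=\mathbf E\times\mathbf F$, and let the iterates $\{z^k=(x^k,y^k)\}_{k\ge0}$ be obtained from the update rule $$P(z^k-z^{k+1})\in\mathcal F(z^{k+1}),\qquad k\ge0.$$ Suppose that the initial solution $z^0=(x^0,y^0)$ is chosen to satisfy the following local initialization assumption: there are an optimal solution $z_{\star0}\in\mathcal Z_\star$ satisfying strict complementarity, a radius $r>0$ and a constant $C>0$, with $\tilde r:=Cr$, such that $z^0\in B_r(z_{\star0})$, $z^k\in B_{\tilde r}(z_{\star0})$ for all $k\ge0$, and $\{z^k\}$ converges to a strictly complementary solution. Suppose moreover that metric subregularity holds with constant $\gamma>0$ on $B_{\tilde r}(z_{\star0})$, i.e. $\gamma\operatorname{dist}(z,\mathcal Z_\star)\le\operatorname{dist}(0,\mathcal F(z))$ for all $z\in B_{\tilde r}(z_{\star0})$. Then for every $k\ge0$, $$\operatorname{dist}(z^k,\mathcal Z_\star)\le\exp\left(1-\frac{k}{\left\lceil e^2\lambda_{\max}^2(P)/\gamma^2\right\rceil}\right)\tilde r.$$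
   Context: $\mathbf E,\mathbf F$ are finite-dimensional Euclidean spaces; $A:\mathbf E\to\mathbf F$ is linear with adjoint $A^\top$; $b\in\mathbf F$, $c\in\mathbf E$; $\mathcal K\subset\mathbf E$ is a closed convex cone and $\mathcal K^*=\{s:\langle s,x\rangle\ge0\ \forall x\in\mathcal K\}$. (P): $\min\{\langle c,x\rangle:Ax=b,\ x\in\mathcal K\}$. (D): $\max\{-\langle b,y\rangle:c+A^\top y=s,\ s\in\mathcal K^*,\ y\in\mathbf F\}$. $\mathcal X_\star,\mathcal Y_\star$ are the sets of optimal $x$ of (P) and optimal $y$ of (D); $\mathcal Z_\star=\mathcal X_\star\times\mathcal Y_\star$. $\operatorname{dist}$ is Euclidean distance ($\operatorname{dist}(0,\emptyset)=+\infty$), $B_r(z)$ the closed ball, $\lambda_{\max}(P)$ the largest eigenvalue of $P$. Saddle subdifferential of the primal-dual form $\min_x\max_y\langle c,x\rangle+\iota_{\mathcal K}(x)+\langle Ax-b,y\rangle$: $\mathcal F(x,y)=\begin{bmatrix} c+A^\top y+N_{\mathcal K}(x) \\ b-Ax \end{bmatrix}$, with $N_{\mathcal K}(x)$ the normal cone of $\mathcal K$ at $x$ (empty if $x\notin\mathcal K$). Strictly complementary solution: $(x_\star,y_\star)$ with $x_\star$ optimal for (P), $y_\star$ optimal for (D), $s_\star=c+A^\top y_\star$, $\langle x_\star,s_\star\rangle=0$, $x_\star\in\operatorname{relint}\{x\in\mathcal K:\langle s_\star,x\rangle=0\}$ and $s_\star\in\operatorname{relint}\{s\in\mathcal K^*:\langle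 s,x_\star\rangle=0\}$. *)

theory Defs
  imports "HOL-Analysis.Analysis"
begin

text \<open>
  Conic problems given by data \<open>A\<close>, \<open>b\<close>, \<open>c\<close>, \<open>K\<close>:
  the primal problem is to minimise \<open>c \<bullet> x\<close> subject to \<open>A x = b\<close>, \<open>x \<in> K\<close>; the dual problem is
  to maximise \<open>- (b \<bullet> y)\<close> subject to \<open>c + adjoint A y \<in> dual_cone K\<close>.  The slack variable
  \<open>s = c + adjoint A y\<close> is determined by \<open>y\<close> and therefore eliminated.  The inner product and norm
  on a product type are the Euclidean ones.
\<close>

definition dual_cone :: "'e::real_inner set \<Rightarrow> 'e set" where
  "dual_cone K = {s. \<forall>x\<in>K. 0 \<le> s \<bullet> x}"

definition normal_cone :: "'e::real_inner set \<Rightarrow> 'e \<Rightarrow> 'e set" where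
  "normal_cone K x = {v. x \<in> K \<and> (\<forall>u\<in>K. v \<bullet> (u - x) \<le> 0)}"

definition primal_solutions ::
  "('e::euclidean_space \<Rightarrow> 'f::euclidean_space) \<Rightarrow> 'f \<Rightarrow> 'e \<Rightarrow> 'e set \<Rightarrow> 'e set" where
  "primal_solutions A b c K = {x. is_arg_min (\<lambda>x. c \<bullet> x) (\<lambda>x. A x = b \<and> x \<in> K) x}"

definition dual_solutions ::
  "('e::euclidean_space \<Rightarrow> 'f::euclidean_space) \<Rightarrow> 'f \<Rightarrow> 'e \<Rightarrow> 'e set \<Rightarrow> 'f set" where
  "dual_solutions A b c K =
     {y. is_arg_max (\<lambda>y. - (b \<bullet> y)) (\<lambda>y. c + adjoint A y \<in> dual_cone K) y}"

definition optimal_pairs ::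
  "('e::euclidean_space \<Rightarrow> 'f::euclidean_space) \<Rightarrow> 'f \<Rightarrow> 'e \<Rightarrow> 'e set \<Rightarrow> ('e \<times> 'f) set" where
  "optimal_pairs A b c K = primal_solutions A b c K \<times> dual_solutions A b c K"

definition saddle_subdiff ::
  "('e::euclidean_space \<Rightarrow> 'f::euclidean_space) \<Rightarrow> 'f \<Rightarrow> 'e \<Rightarrow> 'e set \<Rightarrow> 'e \<times> 'f \<Rightarrow> ('e \<times> 'f) set" where
  "saddle_subdiff A b c K =
     (\<lambda>(x, y). {(c + adjoint A y + v, b - A x) | v. v \<in> normal_cone K x})"

definition strictly_complementary ::
  "('e::euclidean_space \<Rightarrow> 'f::euclidean_space) \<Rightarrow> 'f \<Rightarrow> 'e \<Rightarrow> 'e set \<Rightarrow> 'e \<times> 'f \<Rightarrow> bool" where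
  "strictly_complementary A b c K = (\<lambda>(x, y).
     let s = c + adjoint A y in
       x \<in> primal_solutions A b c K \<and> y \<in> dual_solutions A b c K \<and> x \<bullet> s = 0 \<and>
       x \<in> rel_interior {x' \<in> K. s \<bullet> x' = 0} \<and>
       s \<in> rel_interior {s' \<in> dual_cone K. s' \<bullet> x = 0})"

text \<open>
  The library's \<open>infdist\<close> and \<open>setdist\<close> return 0 for the empty set; here the distance to the
  empty set has to be \<open>\<infinity>\<close>.
\<close>

definition ext_dist :: "'a::metric_space \<Rightarrow> 'a set \<Rightarrow> ereal" where
  "ext_dist z S = (INF s\<in>S. ereal (dist z s))"

definition pos_semidef :: "('a::euclidean_space \<Rightarrow> 'a) \<Rightarrow> bool" where
  "pos_semidef P \<longleftrightarrow> linear P \<and> adjoint P = P \<and> (\<forall>z. 0 \<le> P z \<bullet> z)"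

text \<open>
  For self-adjoint \<open>P\<close> the set of eigenvalues is finite and nonempty, so that \<open>Max\<close> is meaningful.
\<close>

definition lambda_max :: "('a::euclidean_space \<Rightarrow> 'a) \<Rightarrow> real" where
  "lambda_max P = Max {l. \<exists>v. v \<noteq> 0 \<and> P v = l *\<^sub>R v}"

end

(*
  The update is a proximal point step for the monotone operator F, measured in the seminorm
  |v|_P given by |v|_P^2 = <P v, v>.  Monotonicity makes the steps d_k = z_k - z_{k+1}
  nonincreasing in |.|_P and gives |z_{k+1} - s|_P^2 + |d_k|_P^2 <= |z_k - s|_P^2 for every zero
  s of F, so N |d_{m+N-1}|_P^2 <= |z_m - s|_P^2.  Since |P v| <= sqrt(lambda_max) |v|_P and
  |v|_P <= sqrt(lambda_max) |v|, subregularity at z_{m+N}, with S the solution set, yields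
  gamma dist(z_{m+N}, S) <= lambda_max dist(z_m, S) / sqrt N: for N >= e^2 lambda_max^2 / gamma^2
  the distance drops by a factor e every N steps.  The Euclidean distance need not decrease
  within a block, so for k = i + j N with i < N the chain of blocks is started at z_i, whose
  distance to S is at most the radius of the ball containing all the iterates.
*)
theory Submission
  imports Defs
begin

text \<open>The two distances differ only on the empty set. The solution set contains
  \<open>zs0\<close>, so all estimates can be carried out with real numbers.\<close>

lemma ext_dist_eq_infdist:
  assumes "S \<noteq> {}"
  shows "ext_dist z S = ereal (infdist z S)"
proof (rule antisym)
  show "ereal (infdist z S) \<le> ext_dist z S"
    unfolding ext_dist_def by (intro INF_greatest) (simp add: infdist_le)
  show "ext_dist z S \<le> ereal (infdist z S)"
    using assms
    by (auto simp: ext_dist_def infdist_notempty ereal_Inf'[OF bdd_belowI2[of _ 0]] image_image)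
qed


subsection \<open>Positive semidefinite operators\<close>

lemma pos_semidef_inner_commute:
  assumes "pos_semidef P"
  shows "P v \<bullet> w = P w \<bullet> v"
  using assms adjoint_works[of P v w] by (simp add: pos_semidef_def inner_commute)

lemma pos_semidef_quadratic_add:
  assumes "pos_semidef P"
  shows "P (v + w) \<bullet> (v + w) = P v \<bullet> v + 2 * (P v \<bullet> w) + P w \<bullet> w"
  using assms pos_semidef_inner_commute[OF assms, of v w]
  by (simp add: pos_semidef_def linear_add inner_add_left inner_add_right)

text \<open>Expand the nonnegative form at \<open>v - w\<close>. This plays the part of
  Cauchy-Schwarz for the seminorm of \<open>P\<close>.\<close>

lemma pos_semidef_inner_le_mean:
  assumes "pos_semidef P"
  shows "2 * (P v \<bullet> w) \<le> P v \<bullet> v + P w \<bullet> w"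
proof -
  have "0 \<le> P (v + - w) \<bullet> (v + - w)"
    using assms unfolding pos_semidef_def by blast
  moreover have "P (- w) = - P w"
    using assms by (simp add: pos_semidef_def linear_neg)
  ultimately show ?thesis
    using pos_semidef_quadratic_add[OF assms, of v "- w"] by simp
qed

lemma norm_squared_le_quadratic:
  assumes P: "pos_semidef P" and bound: "\<And>v. P v \<bullet> v \<le> l * (norm v)\<^sup>2" and "0 < l"
  shows "(norm (P v))\<^sup>2 \<le> l * (P v \<bullet> v)"
proof -
  \<comment> \<open>With this \<open>w\<close> both \<open>P v \<bullet> w\<close> and the bound on
    \<open>P w \<bullet> w\<close> become |P v|^2 / l, so one copy survives the subtraction.\<close>
  define w where "w = (1 / l) *\<^sub>R P v"
  have "2 * (P v \<bullet> w) \<le> P v \<bullet> v + P w \<bullet> w"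
    by (rule pos_semidef_inner_le_mean[OF P])
  also have "P w \<bullet> w \<le> l * (norm w)\<^sup>2"
    by (rule bound)
  also have "l * (norm w)\<^sup>2 = (norm (P v))\<^sup>2 / l"
    using \<open>0 < l\<close> by (simp add: w_def power_mult_distrib power2_eq_square)
  also have "P v \<bullet> w = (norm (P v))\<^sup>2 / l"
    by (simp add: w_def power2_norm_eq_inner)
  finally show ?thesis
    using \<open>0 < l\<close> by (simp add: field_simps)
qed

text \<open>Eigenvectors of distinct eigenvalues are orthogonal, and a pairwise orthogonal set in a
  Euclidean space is finite. This gives \<open>Max\<close> in \<open>lambda_max\<close> its
  meaning.\<close>

lemma finite_eigenvalues:
  fixes P :: "'a::euclidean_space \<Rightarrow> 'a"
  assumes "pos_semidef P"
  shows "finite {l. \<exists>v. v \<noteq> 0 \<and> P v = l *\<^sub>R v}" (is "finite ?E")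
proof -
  define ev where "ev l = (SOME v. v \<noteq> 0 \<and> P v = l *\<^sub>R v)" for l
  have ev: "ev l \<noteq> 0" "P (ev l) = l *\<^sub>R ev l" if "l \<in> ?E" for l
    using that someI_ex[of "\<lambda>v. v \<noteq> 0 \<and> P v = l *\<^sub>R v"] by (auto simp: ev_def)
  have orth: "ev l \<bullet> ev m = 0" if "l \<in> ?E" "m \<in> ?E" "l \<noteq> m" for l m
    using pos_semidef_inner_commute[OF assms, of "ev l" "ev m"] that
    by (simp add: ev(2) inner_commute)
  have "inj_on ev ?E"
  proof (rule inj_onI, rule ccontr)
    fix l m assume lm: "l \<in> ?E" "m \<in> ?E" "ev l = ev m" "l \<noteq> m"
    have "ev l \<bullet> ev l = 0"
      using orth[OF lm(1,2,4)] by (simp only: lm(3))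
    with ev(1)[OF lm(1)] show False
      by simp
  qed
  moreover have "finite (ev ` ?E)"
    using orth by (intro pairwise_orthogonal_imp_finite) (unfold pairwise_def orthogonal_def, blast)
  ultimately show ?thesis
    using finite_imageD by blast
qed

text \<open>A maximiser \<open>v\<close> of the quadratic form on the unit sphere, with value \<open>l\<close>, is an eigenvector:
  \<open>l - P\<close> is positive semidefinite and its form vanishes at \<open>v\<close>, so it annihilates \<open>v\<close>.\<close>

lemma pos_semidef_attains_quadratic_bound:
  fixes P :: "'a::euclidean_space \<Rightarrow> 'a"
  assumes P: "pos_semidef P"
  obtains l v where "v \<noteq> 0" "P v = l *\<^sub>R v" "\<And>w. P w \<bullet> w \<le> l * (norm w)\<^sup>2"
proof -
  have lin: "linear P"
    using P by (simp add: pos_semidef_def)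
  have "continuous_on (sphere 0 1) (\<lambda>v. P v \<bullet> v)"
    by (intro continuous_intros linear_continuous_on linear_conv_bounded_linear[THEN iffD1] lin)
  then obtain v where v: "norm v = 1" and max: "\<And>w. norm w = 1 \<Longrightarrow> P w \<bullet> w \<le> P v \<bullet> v"
    using continuous_attains_sup[of "sphere (0::'a) 1" "\<lambda>v. P v \<bullet> v"] by auto
  define l where "l = P v \<bullet> v"
  have bound: "P w \<bullet> w \<le> l * (norm w)\<^sup>2" for w
  proof (cases "w = 0")
    case False
    have "P w \<bullet> w = (norm w)\<^sup>2 * (P (sgn w) \<bullet> sgn w)"
      using False by (simp add: sgn_div_norm linear_scale[OF lin] power2_eq_square field_simps)
    then show ?thesis
      using max[of "sgn w"] False by (simp add: l_def norm_sgn mult.commute mult_left_mono)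
  qed (simp add: linear_0[OF lin])
  define Q where "Q w = l *\<^sub>R w - P w" for w
  have linQ: "linear Q"
    by (rule linearI) (simp_all add: Q_def linear_add[OF lin] linear_scale[OF lin] algebra_simps)
  have "adjoint Q = Q"
    by (rule adjoint_unique)
      (simp add: Q_def inner_diff_left inner_diff_right, metis inner_commute pos_semidef_inner_commute[OF P])
  moreover have "0 \<le> Q w \<bullet> w" for w
    using bound[of w] by (simp add: Q_def inner_diff_left power2_norm_eq_inner)
  ultimately have Q: "pos_semidef Q"
    using linQ by (simp add: pos_semidef_def)
  have "0 \<le> l"
    using P by (simp add: l_def pos_semidef_def)
  \<comment> \<open>\<open>norm_squared_le_quadratic\<close> asks for a strictly positive constant,
    while \<open>l\<close> may be 0; hence \<open>l + 1\<close>.\<close>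
  have Qb: "Q w \<bullet> w \<le> (l + 1) * (norm w)\<^sup>2" for w
  proof -
    have "0 \<le> P w \<bullet> w" "0 \<le> (norm w)\<^sup>2"
      using P by (auto simp: pos_semidef_def)
    then show ?thesis
      by (simp add: Q_def inner_diff_left power2_norm_eq_inner algebra_simps)
  qed
  have "Q v \<bullet> v = 0"
    using v by (simp add: Q_def inner_diff_left l_def flip: power2_norm_eq_inner)
  then have "Q v = 0"
    using norm_squared_le_quadratic[OF Q Qb, of v] \<open>0 \<le> l\<close> by simp
  then show thesis
    using that[of v l] v bound by (force simp: Q_def)
qed

lemma quadratic_le_lambda_max:
  assumes P: "pos_semidef P"
  shows "P v \<bullet> v \<le> lambda_max P * (norm v)\<^sup>2"
proof -
  obtain l u where u: "u \<noteq> 0" "P u = l *\<^sub>R u" and l: "\<And>w. P w \<bullet> w \<le> l * (norm w)\<^sup>2"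
    using pos_semidef_attains_quadratic_bound[OF P] by blast
  have "l \<le> lambda_max P"
    unfolding lambda_max_def using u by (intro Max_ge finite_eigenvalues[OF P]) auto
  then have "l * (norm v)\<^sup>2 \<le> lambda_max P * (norm v)\<^sup>2"
    by (simp add: mult_right_mono)
  with l[of v] show ?thesis
    by linarith
qed


subsection \<open>The saddle subdifferential\<close>

text \<open>Normal cones are monotone, and the coupling through \<open>A\<close> and its adjoint is
  skew, so its two contributions cancel.\<close>

lemma saddle_subdiff_monotone:
  assumes A: "linear A"
    and g: "g \<in> saddle_subdiff A b c K w" and g': "g' \<in> saddle_subdiff A b c K w'"
  shows "0 \<le> (g - g') \<bullet> (w - w')"
proof -
  obtain x y x' y' where w: "w = (x, y)" "w' = (x', y')"
    by (cases w, cases w') auto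
  obtain v v' where v: "v \<in> normal_cone K x" "g = (c + adjoint A y + v, b - A x)"
    and v': "v' \<in> normal_cone K x'" "g' = (c + adjoint A y' + v', b - A x')"
    using g g' by (auto simp: saddle_subdiff_def w)
  have "v \<bullet> (x' - x) \<le> 0" "v' \<bullet> (x - x') \<le> 0"
    using v(1) v'(1) by (auto simp: normal_cone_def)
  then have "0 \<le> (v - v') \<bullet> (x - x')"
    by (simp add: inner_diff_left inner_diff_right)
  moreover have "(adjoint A y - adjoint A y') \<bullet> (x - x') = (A x - A x') \<bullet> (y - y')"
    by (simp add: inner_diff_left inner_diff_right inner_commute[of "adjoint A _"]
        adjoint_works[OF A])
  ultimately show ?thesis
    by (simp add: w v v' inner_diff_left inner_diff_right inner_add_left inner_add_right)
qed

text \<open>The right-hand side is the primal objective minus the dual objective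
  \<open>- (b \<bullet> y)\<close>.\<close>

lemma duality_gap:
  fixes A :: "'e::euclidean_space \<Rightarrow> 'f::euclidean_space"
  assumes "linear A" "A x = b"
  shows "(c + adjoint A y) \<bullet> x = c \<bullet> x + b \<bullet> y"
  using adjoint_works[OF assms(1), of x y] assms(2)
  by (simp add: inner_add_left inner_commute[of "adjoint A y"])

text \<open>The pair \<open>zs0\<close> closes the duality gap. Any other optimal pair has a gap
  that is no larger, yet nonnegative by feasibility, so it is complementary too, and minus its slack
  is a normal vector at \<open>x\<close>.\<close>

lemma optimal_pair_is_saddle_zero:
  assumes A: "linear A" and zs0: "strictly_complementary A b c K zs0"
    and w: "w \<in> optimal_pairs A b c K"
  shows "0 \<in> saddle_subdiff A b c K w"
proof -
  obtain x0 y0 x y where eq: "zs0 = (x0, y0)" "w = (x, y)"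
    by (cases zs0, cases w) auto
  have 0: "x0 \<in> primal_solutions A b c K" "y0 \<in> dual_solutions A b c K"
    "x0 \<bullet> (c + adjoint A y0) = 0"
    using zs0 by (auto simp: strictly_complementary_def Let_def eq)
  have 1: "x \<in> primal_solutions A b c K" "y \<in> dual_solutions A b c K"
    using w by (auto simp: optimal_pairs_def eq)
  have "c \<bullet> x \<le> c \<bullet> x0" "- (b \<bullet> y) \<ge> - (b \<bullet> y0)"
    using 0 1 by (auto simp: primal_solutions_def dual_solutions_def is_arg_min_def is_arg_max_def not_less)
  moreover have feas: "A x = b" "x \<in> K" "A x0 = b" "c + adjoint A y \<in> dual_cone K"
    using 0 1 by (auto simp: primal_solutions_def dual_solutions_def is_arg_min_def is_arg_max_def)
  moreover have "0 \<le> (c + adjoint A y) \<bullet> x"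
    using feas by (auto simp: dual_cone_def)
  ultimately have s: "(c + adjoint A y) \<bullet> x = 0"
    using duality_gap[OF A, of x b c y] duality_gap[OF A, of x0 b c y0] 0(3)
    by (simp add: inner_commute)
  have "- (c + adjoint A y) \<bullet> (u - x) \<le> 0" if "u \<in> K" for u
  proof -
    have "0 \<le> (c + adjoint A y) \<bullet> u"
      using feas(4) that by (auto simp: dual_cone_def)
    then show ?thesis
      using s by (simp only: inner_minus_left inner_diff_right)
  qed
  then have "- (c + adjoint A y) \<in> normal_cone K x"
    using feas(2) by (simp add: normal_cone_def)
  then show ?thesis
    using feas(1) by (force simp: saddle_subdiff_def eq zero_prod_def)
qed


subsection \<open>Convergence of the iteration\<close>

lemma step_quadratic_le:
  assumes P: "pos_semidef P"
    and mono: "\<And>g g' w w'. g \<in> F w \<Longrightarrow> g' \<in> F w' \<Longrightarrow> 0 \<le> (g - g') \<bullet> (w - w')"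
    and step: "\<And>k. P (z k - z (Suc k)) \<in> F (z (Suc k))"
    and zs: "0 \<in> F zs"
  shows "real (Suc n) * (P (z (m + n) - z (Suc (m + n))) \<bullet> (z (m + n) - z (Suc (m + n))))
    \<le> P (z m - zs) \<bullet> (z m - zs)"
proof -
  define q where "q v = P v \<bullet> v" for v
  define d where "d k = z k - z (Suc k)" for k
  have q_nonneg: "0 \<le> q v" for v
    using P by (simp add: q_def pos_semidef_def)
  have decr: "q (d (Suc k)) \<le> q (d k)" for k
  proof -
    \<comment> \<open>The two consecutive inclusions live at \<open>z (Suc k)\<close> and
      \<open>z (Suc (Suc k))\<close>, whose difference is \<open>d (Suc k)\<close>.\<close>
    have "0 \<le> (P (d k) - P (d (Suc k))) \<bullet> d (Suc k)"
      using mono[OF step[of k] step[of "Suc k"]] by (simp add: d_def)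
    then show ?thesis
      using pos_semidef_inner_le_mean[OF P, of "d k" "d (Suc k)"]
      by (simp add: q_def inner_diff_left)
  qed
  have fejer: "q (d k) + q (z (Suc k) - zs) \<le> q (z k - zs)" for k
  proof -
    \<comment> \<open>This is the cross term in the expansion of \<open>q\<close> at
      \<open>z k - zs = d k + (z (Suc k) - zs)\<close>.\<close>
    have "0 \<le> P (d k) \<bullet> (z (Suc k) - zs)"
      using mono[OF step[of k] zs] by (simp add: d_def)
    then show ?thesis
      using pos_semidef_quadratic_add[OF P, of "d k" "z (Suc k) - zs"]
      by (simp add: q_def d_def)
  qed
  \<comment> \<open>The remainder \<open>q (z (m + n) - zs)\<close> drives the induction through
    \<open>fejer\<close>; at the end it dominates one more \<open>q (d (m + n))\<close>, which
    raises the factor from \<open>n\<close> to \<open>Suc n\<close>.\<close>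
  have "real n * q (d (m + n)) + q (z (m + n) - zs) \<le> q (z m - zs)"
  proof (induction n)
    case (Suc n)
    have "real (Suc n) * q (d (m + Suc n)) \<le> real (Suc n) * q (d (m + n))"
      using decr[of "m + n"] by (intro mult_left_mono) auto
    then show ?case
      using Suc fejer[of "m + n"] by (simp add: algebra_simps)
  qed simp
  moreover have "q (d (m + n)) \<le> q (z (m + n) - zs)"
    using fejer[of "m + n"] q_nonneg[of "z (Suc (m + n)) - zs"] by linarith
  ultimately show ?thesis
    by (simp add: q_def d_def algebra_simps)
qed

lemma infdist_block_contraction:
  assumes P: "pos_semidef P"
    and mono: "\<And>g g' w w'. g \<in> F w \<Longrightarrow> g' \<in> F w' \<Longrightarrow> 0 \<le> (g - g') \<bullet> (w - w')"
    and step: "\<And>k. P (z k - z (Suc k)) \<in> F (z (Suc k))"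
    and zeros: "\<And>w. w \<in> Z \<Longrightarrow> 0 \<in> F w" and "Z \<noteq> {}"
    and subreg: "\<And>k. \<gamma> * infdist (z (Suc k)) Z \<le> norm (P (z k - z (Suc k)))"
    and "0 < \<gamma>" and lam: "0 < lambda_max P"
    and N: "(exp 1)\<^sup>2 * (lambda_max P)\<^sup>2 / \<gamma>\<^sup>2 \<le> real N"
  shows "exp 1 * infdist (z (m + N)) Z \<le> infdist (z m) Z"
proof -
  define lm where "lm = lambda_max P"
  have "0 < (exp 1)\<^sup>2 * (lambda_max P)\<^sup>2 / \<gamma>\<^sup>2"
    using lam \<open>0 < \<gamma>\<close> by simp
  then obtain n where n: "N = Suc n"
    using N by (cases N) auto
  define d where "d = z (m + n) - z (Suc (m + n))"
  \<comment> \<open>Proved for each solution separately; the infimum over \<open>zs\<close> is taken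
    only at the end, so no nearest point has to be chosen.\<close>
  have bound: "exp 1 * infdist (z (m + N)) Z \<le> dist (z m) zs" if "zs \<in> Z" for zs
  proof -
    \<comment> \<open>One factor \<open>lm\<close> is spent in passing from the norm of
      \<open>P d\<close> to the seminorm, the other in returning from the seminorm to the norm of
      \<open>z m - zs\<close>.\<close>
    have "((exp 1)\<^sup>2 * lm\<^sup>2 / \<gamma>\<^sup>2) * (norm (P d))\<^sup>2 \<le> real N * (norm (P d))\<^sup>2"
      using N by (intro mult_right_mono) (auto simp: lm_def)
    also have "\<dots> \<le> real N * (lm * (P d \<bullet> d))"
      using norm_squared_le_quadratic[OF P quadratic_le_lambda_max[OF P] lam]
      by (intro mult_left_mono) (auto simp: lm_def)
    also have "\<dots> = lm * (real N * (P d \<bullet> d))"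
      by simp
    also have "\<dots> \<le> lm * (P (z m - zs) \<bullet> (z m - zs))"
      unfolding n d_def using lam
      by (intro mult_left_mono step_quadratic_le[where F = F and z = z, OF P mono step zeros[OF that]]) (auto simp: lm_def)
    also have "\<dots> \<le> lm * (lm * (norm (z m - zs))\<^sup>2)"
      using lam by (intro mult_left_mono) (auto simp: lm_def quadratic_le_lambda_max[OF P])
    finally have "(exp 1 * norm (P d))\<^sup>2 \<le> (\<gamma> * norm (z m - zs))\<^sup>2"
      using lam \<open>0 < \<gamma>\<close> by (simp add: lm_def field_simps power2_eq_square)
    then have "exp 1 * norm (P d) \<le> \<gamma> * norm (z m - zs)"
      by (rule power2_le_imp_le) (use \<open>0 < \<gamma>\<close> in auto)
    moreover have "exp 1 * (\<gamma> * infdist (z (m + N)) Z) \<le> exp 1 * norm (P d)"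
      using subreg[of "m + n"] by (intro mult_left_mono) (simp_all add: n d_def)
    ultimately have "\<gamma> * (exp 1 * infdist (z (m + N)) Z) \<le> \<gamma> * dist (z m) zs"
      by (simp only: dist_norm mult.left_commute)
    then show ?thesis
      using \<open>0 < \<gamma>\<close> by simp
  qed
  then show ?thesis
    using \<open>Z \<noteq> {}\<close> by (auto simp: infdist_notempty intro: cINF_greatest)
qed

text \<open>Each residue class modulo \<open>N\<close> contracts by itself, starting at index
  \<open>k mod N\<close>. The 1 in the exponent pays for rounding \<open>k / N\<close> down to
  \<open>k div N\<close>.\<close>

lemma block_contraction_imp_exp_bound:
  fixes D :: "nat \<Rightarrow> real"
  assumes "0 < N" and contr: "\<And>m. exp 1 * D (m + N) \<le> D m" and bound: "\<And>m. D m \<le> R" and "0 \<le> R"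
  shows "D k \<le> exp (1 - real k / real N) * R"
proof -
  have iter: "D (m + j * N) \<le> exp (- real j) * D m" for m j
  proof (induction j)
    case (Suc j)
    have "D (m + Suc j * N) \<le> exp (- 1) * D (m + j * N)"
      using contr[of "m + j * N"] by (simp add: exp_minus field_simps)
    also have "\<dots> \<le> exp (- 1) * (exp (- real j) * D m)"
      using Suc by simp
    also have "\<dots> = exp (- real (Suc j)) * D m"
      by (simp flip: exp_add mult.assoc)
    finally show ?case .
  qed simp
  define j where "j = k div N"
  have "k < Suc j * N"
    unfolding j_def using \<open>0 < N\<close> by (simp add: dividend_less_div_times add.commute)
  then have "real k < real (Suc j) * real N"
    by (metis of_nat_less_iff of_nat_mult)
  then have j: "- real j \<le> 1 - real k / real N"
    using \<open>0 < N\<close> by (simp add: field_simps)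
  have "D k \<le> exp (- real j) * D (k mod N)"
    using iter[of "k mod N" j] by (simp add: j_def)
  also have "\<dots> \<le> exp (1 - real k / real N) * R"
    using bound[of "k mod N"] j \<open>0 \<le> R\<close>
    by (meson exp_ge_zero exp_le_cancel_iff mult_left_mono mult_right_mono order_trans)
  finally show ?thesis .
qed

theorem mainTheorem8:
  fixes A :: "'e::euclidean_space \<Rightarrow> 'f::euclidean_space"
    and b :: 'f and c :: 'e and K :: "'e set"
    and P :: "'e \<times> 'f \<Rightarrow> 'e \<times> 'f"
    and z :: "nat \<Rightarrow> 'e \<times> 'f" and zs0 :: "'e \<times> 'f"
    and r C rt \<gamma> :: real
  assumes "linear A" and "surj A"
    and "closed K" and "convex_cone K"
    and "pos_semidef P"
    and "\<And>k. P (z k - z (Suc k)) \<in> saddle_subdiff A b c K (z (Suc k))"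
    and "strictly_complementary A b c K zs0"
    and "r > 0" and "C > 0" and "rt = C * r"
    and "z 0 \<in> cball zs0 r"
    and "\<And>k. z k \<in> cball zs0 rt"
    and "\<exists>zlim. strictly_complementary A b c K zlim \<and> z \<longlonglongrightarrow> zlim"
    and "\<gamma> > 0"
    and "\<And>w. w \<in> cball zs0 rt \<Longrightarrow>
           ereal \<gamma> * ext_dist w (optimal_pairs A b c K) \<le> ext_dist 0 (saddle_subdiff A b c K w)"
  shows "\<forall>k. ext_dist (z k) (optimal_pairs A b c K)
           \<le> ereal (exp (1 - real k / real_of_int \<lceil>(exp 1)\<^sup>2 * (lambda_max P)\<^sup>2 / \<gamma>\<^sup>2\<rceil>) * rt)"
proof -
  define Z where "Z = optimal_pairs A b c K"
  define N where "N = \<lceil>(exp 1)\<^sup>2 * (lambda_max P)\<^sup>2 / \<gamma>\<^sup>2\<rceil>"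
  have "zs0 \<in> Z"
    using assms(7) by (auto simp: Z_def optimal_pairs_def strictly_complementary_def Let_def)
  then have "Z \<noteq> {}"
    by blast
  have in_ball: "infdist (z k) Z \<le> rt" for k
    using infdist_le[OF \<open>zs0 \<in> Z\<close>, of "z k"] assms(12)[of k] by (simp add: dist_commute)
  have "0 < rt"
    using assms(8-10) by simp
  have subreg: "\<gamma> * infdist (z (Suc k)) Z \<le> norm (P (z k - z (Suc k)))" for k
  proof -
    have "ereal \<gamma> * ext_dist (z (Suc k)) Z \<le> ext_dist 0 (saddle_subdiff A b c K (z (Suc k)))"
      unfolding Z_def by (rule assms(15)[OF assms(12)])
    \<comment> \<open>The update rule exhibits one element of the subdifferential, whose norm bounds
      the distance to 0 from above.\<close>
    also have "\<dots> \<le> ereal (dist 0 (P (z k - z (Suc k))))"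
      unfolding ext_dist_def by (rule INF_lower[OF assms(6)])
    finally show ?thesis
      by (simp add: ext_dist_eq_infdist[OF \<open>Z \<noteq> {}\<close>])
  qed
  have "infdist (z k) Z \<le> exp (1 - real k / real_of_int N) * rt" for k
  proof (cases "lambda_max P = 0")
    \<comment> \<open>Here \<open>N = 0\<close>, and division by zero yields 0, so the claimed bound
      is \<open>exp 1 * rt\<close>, which exceeds the ball radius.\<close>
    case True
    then have "1 * rt \<le> exp (1 - real k / real_of_int N) * rt"
      using \<open>0 < rt\<close> by (intro mult_right_mono) (auto simp: N_def)
    with in_ball[of k] show ?thesis
      by simp
  next
    case False
    obtain v :: "'e \<times> 'f" where "norm v = 1"
      by (rule vector_choose_size[of 1]) simp_all
    moreover have "0 \<le> P v \<bullet> v"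
      using assms(5) unfolding pos_semidef_def by blast
    ultimately have "0 \<le> lambda_max P"
      using quadratic_le_lambda_max[OF assms(5), of v] by simp
    with False have lam: "0 < lambda_max P"
      by simp
    then have "0 < (exp 1)\<^sup>2 * (lambda_max P)\<^sup>2 / \<gamma>\<^sup>2"
      using assms(14) by simp
    then have "0 < N"
      by (simp add: N_def)
    then have N: "real (nat N) = real_of_int N"
      by simp
    have "(exp 1)\<^sup>2 * (lambda_max P)\<^sup>2 / \<gamma>\<^sup>2 \<le> real (nat N)"
      unfolding N by (simp add: N_def)
    then have "exp 1 * infdist (z (m + nat N)) Z \<le> infdist (z m) Z" for m
      using infdist_block_contraction[where F = "saddle_subdiff A b c K" and z = z,
          OF assms(5) saddle_subdiff_monotone[OF assms(1)] assms(6) _ \<open>Z \<noteq> {}\<close> subreg assms(14) lam]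
        optimal_pair_is_saddle_zero[OF assms(1) assms(7)]
      by (simp add: Z_def)
    from block_contraction_imp_exp_bound[where D = "\<lambda>m. infdist (z m) Z", OF _ this in_ball]
    show ?thesis
      using \<open>0 < N\<close> \<open>0 < rt\<close> by (simp add: N)
  qed
  then show ?thesis
    using ext_dist_eq_infdist[OF \<open>Z \<noteq> {}\<close>] by (simp add: Z_def N_def)
qed

end
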